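(* Let $\mathbb{M}$ be a weight sequence with $\gamma(\mathbb{M})>0$. Then, for any $0<\gamma<\gamma(\mathbb{M})$ there exists an optimal $\{\mathbb{M}\}$-flat function in the sector $S_\gamma$.
   Context: A weight sequence is a sequence $\mathbb{M}=(M_p)_{p\in\mathbb{N}_0}$ of positive real numbers ($\mathbb{N}_0=\{0,1,2,\dots\}$) with $M_0=1$, logarithmically convex ($M_p^2\le M_{p-1}M_{p+1}$ for all $p\ge 1$), and such that the quotients $m_p:=M_{p+1}/M_p$ satisfy $\lim_{p\to\infty}m_p=\infty$. Index: a sequence $(c_p)_{p\in\mathbb{N}_0}$ is almost increasing if there is $a>0$ such that $c_p\le a\,c_q$ for all $q\ge p\ge 0$. For a weight sequence, $\gamma(\mathbb{M}):=\sup\{\gamma>0:(m_p/(p+1)^\gamma)_{p\in\mathbb{N}_0}\text{ is almost increasing}\}\in[0,\infty]$ (with $\sup\emptyset=0$). Associated function: $h_{\mathbb{M}}(t):=\inf_{p\in\mathbb{N}_0}M_pt^p$ for $t>0$. Sectors: $\mathcal{R}$ is the Riemann surface of the logarithm and, for $\gamma>0$, $S_\gamma:=\{z\in\mathcal{R}:|\arg z|<\gamma\pi/2\}$. Optimal flat function: given an unbounded sector $S\subset\mathcal{R}$ bisected by direction $0$, a holomorphic function $G\colon S\to\mathbb{C}$ is an optimal $\{\mathbb{M}\}$-flat function in $S$ if (i) there exist $K_1,K_2>0$ such that $K_1h_{\mathbb{M}}(K_2x)\le G(x)$ for all $x>0$ (in particular $G(x)$ is real and positive), and (ii) there exist $K_3,K_4>0$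 such that $|G(z)|\le K_3h_{\mathbb{M}}(K_4|z|)$ for all $z\in S$. *)

theory Defs
  imports "HOL-Complex_Analysis.Complex_Analysis"
begin

section \<open>Weight sequences\<close>

definition quot_seq :: "(nat \<Rightarrow> real) \<Rightarrow> nat \<Rightarrow> real" where
  "quot_seq M p = M (p + 1) / M p"

definition weight_sequence :: "(nat \<Rightarrow> real) \<Rightarrow> bool" where
  "weight_sequence M \<longleftrightarrow>
     (\<forall>p. 0 < M p) \<and> M 0 = 1 \<and>
     (\<forall>p\<ge>1. (M p)\<^sup>2 \<le> M (p - 1) * M (p + 1)) \<and>
     filterlim (quot_seq M) at_top sequentially"

definition almost_increasing :: "(nat \<Rightarrow> real) \<Rightarrow> bool" where
  "almost_increasing c \<longleftrightarrow> (\<exists>a>0. \<forall>p q. p \<le> q \<longrightarrow> c p \<le> a * c q)"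

text \<open>The supremum is taken in \<open>[0, \<infinity>]\<close>, where the supremum of the empty set is \<open>0\<close>.\<close>

definition gamma_index :: "(nat \<Rightarrow> real) \<Rightarrow> ennreal" where
  "gamma_index M =
     Sup (ennreal ` {\<gamma>. 0 < \<gamma> \<and>
            almost_increasing (\<lambda>p. quot_seq M p / (real p + 1) powr \<gamma>)})"

text \<open>Only used for \<open>t > 0\<close> and positive \<open>M\<close>, where the infimum is over a set bounded
  below by \<open>0\<close>.\<close>

definition assoc_fun :: "(nat \<Rightarrow> real) \<Rightarrow> real \<Rightarrow> real" where
  "assoc_fun M t = (INF p. M p * t ^ p)"


section \<open>The Riemann surface of the logarithm\<close>

text \<open>A point of the surface is given by its polar coordinates \<open>(r, \<theta>)\<close>: modulus
  \<open>r > 0\<close> and argument \<open>\<theta> \<in> \<real>\<close>, the argument not being reduced modulo \<open>2 \<pi>\<close>. The topology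
  is that of \<open>real \<times> real\<close>. The complex structure is the one making the projection
  to \<open>\<complex> - {0}\<close> a local biholomorphism.\<close>

definition log_surface :: "(real \<times> real) set" where
  "log_surface = {0<..} \<times> UNIV"

definition log_proj :: "real \<times> real \<Rightarrow> complex" where
  "log_proj z = rcis (fst z) (snd z)"

text \<open>On the log surface the projection is an open map, so \<open>log_proj ` U\<close> below is an open subset
  of the plane.\<close>

definition holomorphic_on_log_surface ::
    "(real \<times> real \<Rightarrow> complex) \<Rightarrow> (real \<times> real) set \<Rightarrow> bool" where
  "holomorphic_on_log_surface G S \<longleftrightarrow>
     S \<subseteq> log_surface \<and>
     (\<forall>z\<in>S. \<exists>U f. open U \<and> z \<in> U \<and> U \<subseteq> S \<and> inj_on log_proj U \<and>
        f holomorphic_on (log_proj ` U) \<and> (\<forall>u\<in>U. G u = f (log_proj u)))"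

definition log_sector :: "real \<Rightarrow> (real \<times> real) set" where
  "log_sector \<gamma> = {z \<in> log_surface. \<bar>snd z\<bar> < \<gamma> * pi / 2}"

lemma log_proj_polar: "log_proj (exp (Re w), Im w) = exp w"
  by (simp add: log_proj_def rcis_def exp_eq_polar)

lemma open_log_sector: "open (log_sector \<gamma>)"
proof -
  have "log_sector \<gamma> = {0<..} \<times> {- (\<gamma> * pi / 2)<..<\<gamma> * pi / 2}"
    by (auto simp: log_sector_def log_surface_def)
  then show ?thesis
    by (simp add: open_Times)
qed

text \<open>In the global coordinate \<open>w = log z = ln r + \<i> \<theta>\<close>, holomorphy is ordinary
  holomorphy.\<close>

lemma holomorphic_on_log_surface_iff:
  assumes S: "open S" "S \<subseteq> log_surface"
  shows "holomorphic_on_log_surface G S \<longleftrightarrow>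
    (\<lambda>w. G (exp (Re w), Im w)) holomorphic_on {w. (exp (Re w), Im w) \<in> S}"
    (is "_ \<longleftrightarrow> ?g holomorphic_on ?L")
proof
  let ?e = "\<lambda>w. (exp (Re w), Im w)"
  have op: "open {w. ?e w \<in> U}" if "open U" for U
  proof -
    have "open (?e -` U)"
      by (rule open_vimage[OF that]) (intro continuous_intros)
    then show ?thesis by (simp add: vimage_def)
  qed
  {
    assume H: "holomorphic_on_log_surface G S"
    show "?g holomorphic_on ?L"
      unfolding holomorphic_on_def
    proof
      fix w assume "w \<in> ?L"
      then have w: "?e w \<in> S" by simp
      obtain U f where U: "open U" "?e w \<in> U" "f holomorphic_on (log_proj ` U)"
        "\<forall>u\<in>U. G u = f (log_proj u)"
        using H[unfolded holomorphic_on_log_surface_def, THEN conjunct2, rule_format, OF w]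
        by (elim exE conjE)
      let ?V = "{v. ?e v \<in> U}"
      have "exp ` ?V \<subseteq> log_proj ` U"
      proof clarify
        fix v assume "?e v \<in> U"
        then show "exp v \<in> log_proj ` U"
          by (rule rev_image_eqI) (simp add: log_proj_polar)
      qed
      then have "(f \<circ> exp) holomorphic_on ?V"
        by (intro holomorphic_on_compose holomorphic_on_exp holomorphic_on_subset[OF U(3)])
      then have "?g holomorphic_on ?V"
        by (rule holomorphic_transform) (simp add: U(4) log_proj_polar)
      then have "?g field_differentiable at w"
        using op[OF U(1)] U(2) by (auto intro: holomorphic_on_imp_differentiable_at)
      then show "?g field_differentiable at w within ?L"
        by (rule field_differentiable_at_within)
    qed
  next
    assume H: "?g holomorphic_on ?L"
    show "holomorphic_on_log_surface G S"
      unfolding holomorphic_on_log_surface_def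
    proof (intro conjI ballI S)
      fix z assume z: "z \<in> S"
      define t where "t = snd z"
      define U where "U = S \<inter> (UNIV \<times> {t - pi/2<..<t + pi/2})"
      define k where "k = (\<lambda>x. Ln (x * cis (- t)) + \<i> * of_real t)"
      have U: "open U" "z \<in> U" "U \<subseteq> S"
        using S z by (auto simp: U_def t_def open_Times mem_Times_iff)
      have k: "k (log_proj u) = Complex (ln (fst u)) (snd u)"
        "0 < Re (log_proj u * cis (- t))" "0 < fst u" if "u \<in> U" for u
      proof -
        have r: "0 < fst u" and a: "\<bar>snd u - t\<bar> < pi/2"
          using that S unfolding U_def log_surface_def mem_Times_iff abs_less_iff
          by (auto simp: mem_Times_iff field_simps)
        have e: "log_proj u * cis (- t) = exp (Complex (ln (fst u)) (snd u - t))"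
          using r by (simp add: log_proj_def rcis_def cis_mult exp_eq_polar mult.assoc)
        have "Ln (log_proj u * cis (- t)) = Complex (ln (fst u)) (snd u - t)"
          unfolding e using a pi_gt_zero by (intro Ln_exp; simp; linarith)
        then show "k (log_proj u) = Complex (ln (fst u)) (snd u)"
          by (simp add: k_def complex_eq_iff)
        have "0 < cos (snd u - t)"
          using a by (intro cos_gt_zero_pi; linarith)
        then show "0 < Re (log_proj u * cis (- t))" unfolding e using r by (simp add: Re_exp)
        show "0 < fst u" by (rule r)
      qed
      have inj: "inj_on log_proj U"
      proof (rule inj_onI)
        fix u v assume uv: "u \<in> U" "v \<in> U" "log_proj u = log_proj v"
        then have "Complex (ln (fst u)) (snd u) = Complex (ln (fst v)) (snd v)"
          by (metis k(1))
        with k(3)[OF uv(1)] k(3)[OF uv(2)] show "u = v"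
          by (simp add: prod_eq_iff)
      qed
      have ek: "(exp (Re (k (log_proj u))), Im (k (log_proj u))) = u" if "u \<in> U" for u
        using k(1,3)[OF that] by simp
      have "k holomorphic_on log_proj ` U"
        unfolding k_def
        by (intro holomorphic_intros) (auto dest: k(2) simp: complex_nonpos_Reals_iff)
      moreover have "k ` log_proj ` U \<subseteq> ?L"
        unfolding image_subset_iff using U(3) ek by auto
      ultimately have "(?g \<circ> k) holomorphic_on log_proj ` U"
        by (intro holomorphic_on_compose holomorphic_on_subset[OF H])
      moreover have "\<forall>u\<in>U. G u = (?g \<circ> k) (log_proj u)"
        using ek by simp
      ultimately show "\<exists>U f. open U \<and> z \<in> U \<and> U \<subseteq> S \<and> inj_on log_proj U \<and>
        f holomorphic_on (log_proj ` U) \<and> (\<forall>u\<in>U. G u = f (log_proj u))"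
        using U inj by (intro exI[of _ U] exI[of _ "?g \<circ> k"] conjI)
    qed
  }
qed


section \<open>Optimal flat functions\<close>

text \<open>The unbounded sectors bisected by direction \<open>0\<close> are the sets \<open>log_sector \<gamma>\<close> with
  \<open>\<gamma> > 0\<close>. The positive real \<open>x\<close> is the point \<open>(x, 0)\<close> of the surface.\<close>

definition optimal_flat ::
    "(nat \<Rightarrow> real) \<Rightarrow> (real \<times> real) set \<Rightarrow> (real \<times> real \<Rightarrow> complex) \<Rightarrow> bool" where
  "optimal_flat M S G \<longleftrightarrow>
     (\<exists>\<gamma>>0. S = log_sector \<gamma>) \<and>
     holomorphic_on_log_surface G S \<and>
     (\<exists>K1>0. \<exists>K2>0. \<forall>x>0. G (x, 0) \<in> \<real> \<and> K1 * assoc_fun M (K2 * x) \<le> Re (G (x, 0))) \<and>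
     (\<exists>K3>0. \<exists>K4>0. \<forall>z\<in>S. cmod (G z) \<le> K3 * assoc_fun M (K4 * fst z))"

end

theory Submission
  imports Defs
begin

text \<open>
  Write \<open>m\<^sub>p\<close> for the quotients, so that \<open>M\<^sub>p = \<Prod>\<^sub>j\<^sub><\<^sub>p m\<^sub>j\<close>. Choose \<open>\<gamma>' > \<gamma>\<close> with
  \<open>m\<^sub>p / (p + 1)\<^sup>\<gamma>\<^sup>'\<close> almost increasing; then \<open>\<Sum>\<^sub>j m\<^sub>j\<^sup>-\<^sup>1\<^sup>/\<^sup>\<gamma>\<close> converges, and
  \<open>G(z) = \<Prod>\<^sub>j (1 + (m\<^sub>j z)\<^sup>-\<^sup>1\<^sup>/\<^sup>\<gamma>)\<^sup>-\<^sup>\<gamma>\<close> is holomorphic in \<open>S\<^sub>\<gamma>\<close>, where the numbers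
  \<open>w\<^sub>j = (m\<^sub>j z)\<^sup>-\<^sup>1\<^sup>/\<^sup>\<gamma>\<close> have positive real part. Since \<open>\<bar>1 + w\<^sub>j\<bar> \<ge> max 1 \<bar>w\<^sub>j\<bar>\<close>, the first
  \<open>p\<close> factors give \<open>\<bar>G(z)\<bar> \<le> M\<^sub>p \<bar>z\<bar>\<^sup>p\<close> for every \<open>p\<close>. For \<open>x > 0\<close> let \<open>N\<close> be the first index
  with \<open>m\<^sub>N x \<ge> 1\<close>: the factors with \<open>j < N\<close> are at least \<open>2\<^sup>-\<^sup>\<gamma> m\<^sub>j x\<close>, and the remaining ones
  contribute at least \<open>exp (- C (N + 1))\<close> because \<open>\<Sum>\<^sub>j\<^sub>\<ge>\<^sub>N (m\<^sub>N / m\<^sub>j)\<^sup>1\<^sup>/\<^sup>\<gamma> = O(N + 1)\<close>. Hence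
  \<open>G(x)\<close> is at least a constant times \<open>M\<^sub>N (K x)\<^sup>N\<close> with \<open>K\<close> independent of \<open>x\<close>.
\<close>

section \<open>Power sums and sums of ratios of quotients\<close>

text \<open>A mean value estimate for \<open>t powr (- e)\<close> over a unit step, in the form that
  makes power sums telescope. It follows from \<open>ln y \<le> y - 1\<close> and
  \<open>1 + y \<le> exp y\<close>.\<close>

lemma powr_minus_diff_ge:
  fixes x e :: real
  assumes "0 < x" "0 \<le> e"
  shows "e * (x + 1) powr (- 1 - e) \<le> x powr (- e) - (x + 1) powr (- e)"
proof -
  have "ln (x / (x + 1)) \<le> x / (x + 1) - 1"
    using assms by (intro ln_le_minus_one) simp
  also have "\<dots> = - 1 / (x + 1)"
    using assms by (simp add: field_simps)
  finally have "1 / (x + 1) \<le> ln (x + 1) - ln x"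
    using assms by (simp add: ln_div)
  then have "e * (1 / (x + 1)) \<le> e * (ln (x + 1) - ln x)"
    using assms by (intro mult_left_mono) auto
  also have "\<dots> \<le> exp (e * (ln (x + 1) - ln x)) - 1"
    using exp_ge_add_one_self[of "e * (ln (x + 1) - ln x)"] by linarith
  finally have "e * (1 / (x + 1)) * (x + 1) powr (- e)
      \<le> (exp (e * (ln (x + 1) - ln x)) - 1) * (x + 1) powr (- e)"
    by (intro mult_right_mono) auto
  moreover have "(x + 1) powr (- 1 - e) = 1 / (x + 1) * (x + 1) powr (- e)"
    using assms by (simp add: powr_diff powr_minus field_simps)
  moreover have "exp (e * (ln (x + 1) - ln x)) * (x + 1) powr (- e) = x powr (- e)"
    using assms by (simp add: powr_def exp_add[symmetric] algebra_simps)
  ultimately show ?thesis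
    by (simp add: algebra_simps)
qed

lemma sum_powr_ratio_le:
  fixes x d :: real
  assumes "1 \<le> x" "1 < d"
  shows "(\<Sum>j<n. (x / (x + real j)) powr d) \<le> d / (d - 1) * x"
proof -
  define e where "e = d - 1"
  have e: "0 < e" "d = 1 + e"
    using assms by (auto simp: e_def)
  \<comment> \<open>The estimate bounds the term at \<open>x + j + 1\<close> by a difference
    starting at \<open>x + j\<close>, so the first term stays apart.\<close>
  have S: "(\<Sum>j<Suc n. (x + real j) powr (- d))
      \<le> x powr (- d) + (x powr (- e) - (x + real n) powr (- e)) / e" for n
  proof (induction n)
    case (Suc n)
    have "(x + real n + 1) powr (- d)
        \<le> ((x + real n) powr (- e) - (x + real n + 1) powr (- e)) / e"
      using powr_minus_diff_ge[of "x + real n" e] assms(1) e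
      by (simp add: field_simps)
    then show ?case
      using Suc by (simp add: diff_divide_distrib add_ac)
  qed simp
  have "(\<Sum>j<n. (x + real j) powr (- d)) \<le> (\<Sum>j<Suc n. (x + real j) powr (- d))"
    by simp
  also have "\<dots> \<le> x powr (- d) + x powr (- e) / e"
    using S[of n] e by (smt (verit) divide_right_mono powr_ge_zero)
  finally have "x powr d * (\<Sum>j<n. (x + real j) powr (- d))
      \<le> x powr d * (x powr (- d) + x powr (- e) / e)"
    by (intro mult_left_mono) auto
  also have "\<dots> = 1 + x / e"
    using assms e by (simp add: distrib_left powr_add[symmetric])
  \<comment> \<open>Here \<open>1 \<le> x\<close> absorbs the summand 1, and
    \<open>1 + 1 / e = d / (d - 1)\<close>.\<close>
  also have "\<dots> \<le> d / (d - 1) * x"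
    using assms e by (simp add: field_simps)
  also have "x powr d * (\<Sum>j<n. (x + real j) powr (- d)) = (\<Sum>j<n. (x / (x + real j)) powr d)"
    unfolding sum_distrib_left
    using assms by (intro sum.cong refl) (simp add: powr_divide powr_minus_divide)
  finally show ?thesis .
qed

text \<open>Almost increase bounds \<open>m N / m (N + j)\<close> by a constant times
  \<open>((N + 1) / (N + 1 + j)) powr c'\<close>. The power \<open>1 / c\<close> turns the exponent
  into \<open>c' / c > 1\<close>, which leaves a convergent power sum. Growth only linear in
  \<open>N\<close> is what later costs no more than a geometric factor.\<close>

lemma sum_quotient_ratio_le:
  fixes m :: "nat \<Rightarrow> real"
  assumes ai: "almost_increasing (\<lambda>p. m p / (real p + 1) powr c')"
    and m: "\<And>p. 0 < m p" and c: "0 < c" "c < c'"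
  obtains C where "0 < C"
    "\<And>N n. (\<Sum>j<n. (m N / m (N + j)) powr (1 / c)) \<le> C * (real N + 1)"
proof -
  obtain a where a: "0 < a"
    "\<And>p q. p \<le> q \<Longrightarrow> m p / (real p + 1) powr c' \<le> a * (m q / (real q + 1) powr c')"
    using ai unfolding almost_increasing_def by blast
  define d where "d = c' / c"
  have d: "1 < d"
    using c by (simp add: d_def)
  define C where "C = a powr (1 / c) * (d / (d - 1))"
  have "(\<Sum>j<n. (m N / m (N + j)) powr (1 / c)) \<le> C * (real N + 1)" for N n
  proof -
    have "(m N / m (N + j)) powr (1 / c)
        \<le> a powr (1 / c) * ((real N + 1) / (real N + 1 + real j)) powr d" for j
    proof -
      have "m N / m (N + j) \<le> a * ((real N + 1) / (real N + 1 + real j)) powr c'"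
        using a(2)[of N "N + j"] m[of "N + j"] by (simp add: powr_divide field_simps)
      then have "(m N / m (N + j)) powr (1 / c)
          \<le> (a * ((real N + 1) / (real N + 1 + real j)) powr c') powr (1 / c)"
        using m[of N] m[of "N + j"] c by (intro powr_mono2) auto
      then show ?thesis
        using a(1) by (simp add: powr_mult powr_powr d_def)
    qed
    then have "(\<Sum>j<n. (m N / m (N + j)) powr (1 / c))
        \<le> a powr (1 / c) * (\<Sum>j<n. ((real N + 1) / (real N + 1 + real j)) powr d)"
      unfolding sum_distrib_left by (intro sum_mono)
    also have "\<dots> \<le> a powr (1 / c) * (d / (d - 1) * (real N + 1))"
      using d by (intro mult_left_mono sum_powr_ratio_le) auto
    finally show ?thesis
      by (simp add: C_def)
  qed
  moreover have "0 < C"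
    using a(1) d by (simp add: C_def)
  ultimately show ?thesis
    using that by blast
qed

section \<open>Series of complex logarithms\<close>

text \<open>The derivative \<open>1 / (1 + u)\<close> has norm at most 1 on the closed right
  half-plane, which is convex and contains 0.\<close>

lemma norm_Ln_one_plus_le:
  assumes "0 \<le> Re z"
  shows "norm (Ln (1 + z)) \<le> norm z"
proof -
  have "norm (Ln (1 + z) - Ln (1 + 0)) \<le> 1 * norm (z - 0)"
  proof (rule field_differentiable_bound)
    show "convex {z. 0 \<le> Re z}"
      by (rule convex_halfspace_Re_ge)
  next
    fix u assume "u \<in> {z. 0 \<le> Re z}"
    then have u: "0 \<le> Re u" by simp
    then show "((\<lambda>z. Ln (1 + z)) has_field_derivative 1 / (1 + u)) (at u within {z. 0 \<le> Re z})"
      by (auto intro!: derivative_eq_intros simp: complex_nonpos_Reals_iff divide_inverse)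
    have "1 \<le> norm (1 + u)"
      using u complex_Re_le_cmod[of "1 + u"] by simp
    then show "norm (1 / (1 + u)) \<le> 1"
      by (auto simp: norm_divide divide_le_eq)
  qed (use assms in auto)
  then show ?thesis by simp
qed

lemma summable_Ln_one_plus:
  fixes a :: "nat \<Rightarrow> real"
  assumes "summable a" "\<And>j. 0 \<le> a j" "0 \<le> Re z"
  shows "summable (\<lambda>j. Ln (1 + of_real (a j) * z))"
proof (rule summable_comparison_test')
  show "summable (\<lambda>j. a j * norm z)"
    using assms(1) by (rule summable_mult2)
  show "norm (Ln (1 + of_real (a j) * z)) \<le> a j * norm z" for j
    using norm_Ln_one_plus_le[of "of_real (a j) * z"] assms by (simp add: norm_mult)
qed

text \<open>On a closed disc inside the half-plane the terms have the summable majorant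
  \<open>a j * (norm x + d)\<close>, so the partial sums converge locally uniformly.\<close>

lemma holomorphic_on_suminf_Ln_one_plus:
  fixes a :: "nat \<Rightarrow> real"
  assumes a: "summable a" "\<And>j. 0 \<le> a j"
  shows "(\<lambda>z. \<Sum>j. Ln (1 + of_real (a j) * z)) holomorphic_on {z. 0 < Re z}"
proof (rule holomorphic_uniform_sequence[where f = "\<lambda>n z. \<Sum>j<n. Ln (1 + of_real (a j) * z)"])
  show "open {z. 0 < Re z}"
    by (rule open_halfspace_Re_gt)
next
  fix n
  show "(\<lambda>z. \<Sum>j<n. Ln (1 + of_real (a j) * z)) holomorphic_on {z. 0 < Re z}"
    using a(2) by (intro holomorphic_intros)
      (auto simp: complex_nonpos_Reals_iff not_le intro!: add_pos_nonneg)
next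
  fix x assume "x \<in> {z. 0 < Re z}"
  then obtain d where d: "0 < d" "cball x d \<subseteq> {z. 0 < Re z}"
    using open_contains_cball[of "{z. 0 < Re z}"] open_halfspace_Re_gt[of 0] by blast
  have "uniform_limit (cball x d) (\<lambda>n z. \<Sum>j<n. Ln (1 + of_real (a j) * z))
      (\<lambda>z. \<Sum>j. Ln (1 + of_real (a j) * z)) sequentially"
  proof (rule Weierstrass_m_test)
    show "summable (\<lambda>j. a j * (norm x + d))"
      using a(1) by (rule summable_mult2)
    fix j z assume z: "z \<in> cball x d"
    then have "0 < Re z" using d by blast
    then have "norm (Ln (1 + of_real (a j) * z)) \<le> a j * norm z"
      using norm_Ln_one_plus_le[of "of_real (a j) * z"] a(2) by (simp add: norm_mult)
    also have "norm z \<le> norm x + d"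
      using z norm_triangle_ineq2[of z x] by (simp add: dist_norm norm_minus_commute)
    finally show "norm (Ln (1 + of_real (a j) * z)) \<le> a j * (norm x + d)"
      using a(2) by (simp add: mult_left_mono)
  qed
  with d show "\<exists>d>0. cball x d \<subseteq> {z. 0 < Re z} \<and>
      uniform_limit (cball x d) (\<lambda>n z. \<Sum>j<n. Ln (1 + of_real (a j) * z))
        (\<lambda>z. \<Sum>j. Ln (1 + of_real (a j) * z)) sequentially"
    by blast
qed

section \<open>The flat product and its two bounds\<close>

lemma prod_quot_seq:
  assumes "\<And>p. M p \<noteq> 0"
  shows "(\<Prod>j<p. quot_seq M j) = M p / M 0"
  using assms by (induction p) (auto simp: quot_seq_def)

lemma assoc_fun_le:
  assumes "\<And>p. 0 \<le> M p" "0 \<le> t"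
  shows "assoc_fun M t \<le> M p * t ^ p"
  unfolding assoc_fun_def
  by (rule cINF_lower) (use assms in \<open>auto intro!: bdd_belowI[of _ 0]\<close>)

text \<open>The function \<open>G\<close> of the header, with \<open>(r, \<theta>)\<close> in place of \<open>z\<close>.\<close>

definition flat_product :: "(nat \<Rightarrow> real) \<Rightarrow> real \<Rightarrow> real \<times> real \<Rightarrow> complex" where
  "flat_product m \<gamma> z = exp (- of_real \<gamma> *
     (\<Sum>j. Ln (1 + of_real (m j powr (- 1 / \<gamma>)) * exp (- Complex (ln (fst z)) (snd z) / of_real \<gamma>))))"

text \<open>The exponential is the branch of the power \<open>-1 / \<gamma>\<close> of
  \<open>z\<close> on the log surface. Its argument is \<open>- snd z / \<gamma>\<close>, which the
  opening of the sector keeps within a right angle of 0.\<close>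

lemma Re_exp_log_sector:
  assumes "0 < \<gamma>" "z \<in> log_sector \<gamma>"
  shows "0 < Re (exp (- Complex (ln (fst z)) (snd z) / of_real \<gamma>))"
proof -
  have "\<bar>snd z / \<gamma>\<bar> < pi / 2"
    using assms by (simp add: log_sector_def field_simps)
  then have "0 < cos (snd z / \<gamma>)"
    by (intro cos_gt_zero_pi) linarith+
  then show ?thesis
    by (simp add: Re_exp)
qed

lemma holomorphic_flat_product:
  assumes a: "summable (\<lambda>j. m j powr (- 1 / \<gamma>))" and "0 < \<gamma>"
  shows "holomorphic_on_log_surface (flat_product m \<gamma>) (log_sector \<gamma>)"
proof -
  let ?L = "{w. (exp (Re w), Im w) \<in> log_sector \<gamma>}"
  have "(\<lambda>w. exp (- w / of_real \<gamma>)) ` ?L \<subseteq> {z. 0 < Re z}"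
    using Re_exp_log_sector[OF assms(2)] by fastforce
  then have "((\<lambda>z. \<Sum>j. Ln (1 + of_real (m j powr (- 1 / \<gamma>)) * z)) \<circ> (\<lambda>w. exp (- w / of_real \<gamma>)))
      holomorphic_on ?L"
    using assms
    by (intro holomorphic_on_compose holomorphic_intros
          holomorphic_on_subset[OF holomorphic_on_suminf_Ln_one_plus[OF a]]) auto
  then have "(\<lambda>w. flat_product m \<gamma> (exp (Re w), Im w)) holomorphic_on ?L"
    unfolding flat_product_def o_def by (auto intro!: holomorphic_intros)
  moreover have "log_sector \<gamma> \<subseteq> log_surface"
    by (auto simp: log_sector_def)
  ultimately show ?thesis
    by (simp add: holomorphic_on_log_surface_iff open_log_sector)
qed

lemma norm_flat_product_le:
  assumes a: "summable (\<lambda>j. m j powr (- 1 / \<gamma>))" and "0 < \<gamma>" and m: "\<And>j. 0 < m j"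
    and z: "z \<in> log_sector \<gamma>"
  shows "norm (flat_product m \<gamma> z) \<le> (\<Prod>j<p. m j * fst z)"
proof -
  define u where "u = exp (- Complex (ln (fst z)) (snd z) / of_real \<gamma>)"
  define b where "b = (\<lambda>j. of_real (m j powr (- 1 / \<gamma>)) * u)"
  have r: "0 < fst z"
    using z by (auto simp: log_sector_def log_surface_def)
  have u: "0 < Re u"
    unfolding u_def by (rule Re_exp_log_sector) fact+
  have "norm u = fst z powr (- 1 / \<gamma>)"
    using r by (simp add: u_def powr_def)
  then have nb: "norm (b j) = (m j * fst z) powr (- 1 / \<gamma>)" for j
    using m[of j] r by (simp add: b_def norm_mult powr_mult)
  have Rb: "0 \<le> Re (b j)" for j
    using u by (simp add: b_def)
  have sm: "summable (\<lambda>j. Ln (1 + b j))"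
    unfolding b_def using a u by (intro summable_Ln_one_plus) auto
  have ne: "1 + b j \<noteq> 0" for j
    using Rb[of j] by (auto simp: complex_eq_iff)
  have ReLn: "0 \<le> Re (Ln (1 + b j))" for j
    using complex_Re_le_cmod[of "1 + b j"] Rb[of j] ne[of j] by simp
  \<comment> \<open>The left side is \<open>ln (norm (b j))\<close>.\<close>
  have ReLn2: "- ln (m j * fst z) / \<gamma> \<le> Re (Ln (1 + b j))" for j
  proof -
    have "norm (b j) \<le> norm (1 + b j)"
      using Rb[of j] by (simp add: cmod_def power_mono)
    then have "ln (norm (b j)) \<le> ln (norm (1 + b j))"
      using m[of j] r by (intro ln_mono) (auto simp: nb)
    then show ?thesis
      using m[of j] r ne[of j] by (simp add: nb ln_powr)
  qed
  have "(\<Sum>j<p. - ln (m j * fst z) / \<gamma>) \<le> (\<Sum>j<p. Re (Ln (1 + b j)))"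
    by (intro sum_mono ReLn2)
  also have "\<dots> \<le> (\<Sum>j. Re (Ln (1 + b j)))"
    using ReLn summable_Re[OF sm] by (intro sum_le_suminf) auto
  also have "\<dots> = Re (\<Sum>j. Ln (1 + b j))"
    using sm by (simp add: Re_suminf)
  finally have "- \<gamma> * Re (\<Sum>j. Ln (1 + b j)) \<le> (\<Sum>j<p. ln (m j * fst z))"
    using assms(2) by (simp add: sum_negf sum_divide_distrib[symmetric] field_simps)
  then have "exp (- \<gamma> * Re (\<Sum>j. Ln (1 + b j))) \<le> exp (\<Sum>j<p. ln (m j * fst z))"
    by simp
  also have "\<dots> = (\<Prod>j<p. m j * fst z)"
    using m r by (simp add: exp_sum)
  finally show ?thesis
    by (simp add: flat_product_def b_def u_def)
qed

lemma flat_product_of_real: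
  assumes a: "summable (\<lambda>j. m j powr (- 1 / \<gamma>))" and "0 < \<gamma>" and m: "\<And>j. 0 < m j"
    and x: "0 < x"
  shows "summable (\<lambda>j. ln (1 + (m j * x) powr (- 1 / \<gamma>)))"
    and "flat_product m \<gamma> (x, 0)
      = of_real (exp (- \<gamma> * (\<Sum>j. ln (1 + (m j * x) powr (- 1 / \<gamma>)))))"
proof -
  define b where "b = (\<lambda>j. (m j * x) powr (- 1 / \<gamma>))"
  have "exp (- Complex (ln x) 0 / of_real \<gamma>) = of_real (x powr (- 1 / \<gamma>))"
    using x by (simp add: powr_def exp_of_real[symmetric] complex_of_real_def[symmetric])
  then have L: "Ln (1 + of_real (m j powr (- 1 / \<gamma>)) * exp (- Complex (ln x) 0 / of_real \<gamma>))
      = of_real (ln (1 + b j))" for j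
    using m[of j] x Ln_of_real[of "1 + b j"]
    by (simp add: b_def powr_mult add_pos_nonneg)
  have "summable (\<lambda>j. b j)"
    using summable_mult2[OF a, of "x powr (- 1 / \<gamma>)"] m x by (simp add: b_def powr_mult less_imp_le)
  then have s: "summable (\<lambda>j. ln (1 + b j))"
    by (rule summable_comparison_test') (simp add: b_def ln_add_one_self_le_self)
  then show "summable (\<lambda>j. ln (1 + (m j * x) powr (- 1 / \<gamma>)))"
    by (simp add: b_def)
  show "flat_product m \<gamma> (x, 0)
      = of_real (exp (- \<gamma> * (\<Sum>j. ln (1 + (m j * x) powr (- 1 / \<gamma>)))))"
    using s unfolding flat_product_def fst_conv snd_conv L
    by (simp add: suminf_of_real[symmetric] exp_of_real[symmetric] b_def)
qed

text \<open>The tail costs \<open>exp (- \<gamma> * C * (N + 1))\<close>. One factor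
  \<open>exp (- \<gamma> * C)\<close> stays in front; the other \<open>N\<close> join the losses
  \<open>2 powr (- \<gamma>)\<close> of the first \<open>N\<close> factors and rescale
  \<open>x\<close>.\<close>

lemma flat_product_ge:
  assumes a: "summable (\<lambda>j. m j powr (- 1 / \<gamma>))" and g: "0 < \<gamma>" and m: "\<And>j. 0 < m j"
    and C: "\<And>n. (\<Sum>j<n. (m N / m (N + j)) powr (1 / \<gamma>)) \<le> C * (real N + 1)"
    and x: "0 < x" and N: "1 \<le> m N * x" "\<And>j. j < N \<Longrightarrow> m j * x < 1"
  shows "exp (- \<gamma> * C) * (\<Prod>j<N. m j * (exp (- \<gamma> * (ln 2 + C)) * x)) \<le> Re (flat_product m \<gamma> (x, 0))"
proof -
  define b where "b j = (m j * x) powr (- 1 / \<gamma>)" for j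
  note real = flat_product_of_real[OF a g m x, folded b_def]
  have b: "0 < b j" for j
    using m[of j] x by (simp add: b_def)
  have "(\<Sum>j. ln (1 + b (j + N))) \<le> C * (real N + 1)"
  proof (rule suminf_le_const)
    show "summable (\<lambda>j. ln (1 + b (j + N)))"
      using real(1) by (rule summable_ignore_initial_segment)
    fix n
    have "ln (1 + b (j + N)) \<le> (m N / m (N + j)) powr (1 / \<gamma>)" for j
    proof -
      have "ln (1 + b (j + N)) \<le> b (j + N)"
        using b[of "j + N"] by (simp add: ln_add_one_self_le_self)
      also have "\<dots> = (1 / (m (N + j) * x)) powr (1 / \<gamma>)"
        using m[of "N + j"] x by (simp add: b_def powr_divide powr_minus_divide add.commute)
      also have "\<dots> \<le> (m N / m (N + j)) powr (1 / \<gamma>)"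
        using N(1) m[of "N + j"] x g by (intro powr_mono2) (auto simp: field_simps)
      finally show ?thesis .
    qed
    then have "(\<Sum>j<n. ln (1 + b (j + N))) \<le> (\<Sum>j<n. (m N / m (N + j)) powr (1 / \<gamma>))"
      by (intro sum_mono)
    with C[of n] show "(\<Sum>j<n. ln (1 + b (j + N))) \<le> C * (real N + 1)"
      by linarith
  qed
  moreover have "(\<Sum>j<N. ln (1 + b j)) \<le> (\<Sum>j<N. ln 2 - ln (m j * x) / \<gamma>)"
  proof (rule sum_mono)
    fix j assume "j \<in> {..<N}"
    then have "1 \<le> b j"
      using N(2)[of j] m[of j] x g powr_mono2'[of "- 1 / \<gamma>" "m j * x" 1]
      by (simp add: b_def)
    \<comment> \<open>Since \<open>1 \<le> b j\<close>, the sum \<open>1 + b j\<close> is at most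
      \<open>2 * b j\<close>.\<close>
    then have "ln (1 + b j) \<le> ln (2 * b j)"
      by simp
    also have "\<dots> = ln 2 - ln (m j * x) / \<gamma>"
      using b[of j] m[of j] x by (simp add: ln_mult_pos b_def ln_powr)
    finally show "ln (1 + b j) \<le> ln 2 - ln (m j * x) / \<gamma>" .
  qed
  ultimately have "(\<Sum>j. ln (1 + b j))
      \<le> C * (real N + 1) + (\<Sum>j<N. ln 2 - ln (m j * x) / \<gamma>)"
    using suminf_split_initial_segment[OF real(1), of N] by linarith
  then have "- \<gamma> * (C * (real N + 1) + (\<Sum>j<N. ln 2 - ln (m j * x) / \<gamma>))
      \<le> - \<gamma> * (\<Sum>j. ln (1 + b j))"
    using g by simp
  moreover have "- \<gamma> * (C * (real N + 1) + (\<Sum>j<N. ln 2 - ln (m j * x) / \<gamma>))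
      = - \<gamma> * C + (\<Sum>j<N. ln (m j * x) - \<gamma> * (ln 2 + C))"
    using g by (simp add: sum_subtractf sum_divide_distrib[symmetric] field_simps)
  ultimately have "exp (- \<gamma> * C + (\<Sum>j<N. ln (m j * x) - \<gamma> * (ln 2 + C)))
      \<le> exp (- \<gamma> * (\<Sum>j. ln (1 + b j)))"
    by simp
  moreover have "exp (ln (m j * x) - \<gamma> * (ln 2 + C)) = m j * (exp (- \<gamma> * (ln 2 + C)) * x)" for j
    using m[of j] x by (simp add: exp_diff exp_minus divide_inverse mult_ac)
  ultimately show ?thesis
    by (simp only: real(2) Re_complex_of_real exp_add exp_sum finite_lessThan)
qed

section \<open>Choice of parameters and verification of optimal flatness\<close>

theorem proposition3p10:
  fixes M :: "nat \<Rightarrow> real" and \<gamma> :: real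
  assumes "weight_sequence M"
    and "0 < gamma_index M"
    and "0 < \<gamma>" and "ennreal \<gamma> < gamma_index M"
  shows "\<exists>G. optimal_flat M (log_sector \<gamma>) G"
proof -
  define m where "m = quot_seq M"
  have M: "\<And>p. 0 < M p" "M 0 = 1" and lim: "filterlim m at_top sequentially"
    using assms(1) by (auto simp: weight_sequence_def m_def)
  have m: "0 < m p" for p
    using M(1) by (simp add: m_def quot_seq_def)
  have prod_m: "(\<Prod>j<p. m j * t) = M p * t ^ p" for p t
    using prod_quot_seq[of M p] M by (simp add: prod.distrib m_def less_imp_neq[symmetric])
  \<comment> \<open>Some admissible exponent lies strictly above \<open>\<gamma>\<close>, since
    \<open>\<gamma>\<close> is below the supremum.\<close>
  obtain \<gamma>' where g': "\<gamma> < \<gamma>'" "almost_increasing (\<lambda>p. m p / (real p + 1) powr \<gamma>')"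
    using assms(3,4) by (auto simp: gamma_index_def less_Sup_iff ennreal_less_iff m_def)
  obtain C where C: "0 < C"
    "\<And>N n. (\<Sum>j<n. (m N / m (N + j)) powr (1 / \<gamma>)) \<le> C * (real N + 1)"
    using sum_quotient_ratio_le[OF g'(2) m assms(3) g'(1)] by blast
  \<comment> \<open>The case \<open>N = 0\<close> of the ratio bound gives convergence of the series
    defining the product.\<close>
  have "summable (\<lambda>j. (m 0 / m (0 + j)) powr (1 / \<gamma>))"
    by (rule summableI_nonneg_bounded) (use C(2)[of 0] in auto)
  moreover have "(m 0 / m (0 + j)) powr (1 / \<gamma>) = m 0 powr (1 / \<gamma>) * m j powr (- 1 / \<gamma>)" for j
    using m[of 0] m[of j] by (simp add: powr_divide powr_minus_divide)
  ultimately have "summable (\<lambda>j. m 0 powr (1 / \<gamma>) * m j powr (- 1 / \<gamma>))"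
    by simp
  then have a: "summable (\<lambda>j. m j powr (- 1 / \<gamma>))"
    using m[of 0] by (simp add: summable_cmult_iff)
  define K where "K = exp (- \<gamma> * (ln 2 + C))"
  have "exp (- \<gamma> * C) * assoc_fun M (K * x) \<le> Re (flat_product m \<gamma> (x, 0))" if x: "0 < x" for x
  proof -
    \<comment> \<open>Such an index exists because \<open>m\<close> tends to infinity. The infimum
      \<open>assoc_fun M (K * x)\<close> is then bounded by its \<open>N\<close>-th term.\<close>
    define N where "N = (LEAST j. 1 \<le> m j * x)"
    have "\<forall>\<^sub>F j in sequentially. 1 / x \<le> m j"
      using lim by (simp add: filterlim_at_top)
    then obtain j where "1 \<le> m j * x"
      using x by (auto simp: eventually_sequentially field_simps)
    then have N: "1 \<le> m N * x" "\<And>j. j < N \<Longrightarrow> m j * x < 1"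
      unfolding N_def by (auto intro: LeastI dest: not_less_Least)
    have "exp (- \<gamma> * C) * assoc_fun M (K * x) \<le> exp (- \<gamma> * C) * (\<Prod>j<N. m j * (K * x))"
      unfolding prod_m using M(1) x
      by (intro mult_left_mono assoc_fun_le) (auto simp: K_def less_imp_le)
    also have "\<dots> \<le> Re (flat_product m \<gamma> (x, 0))"
      unfolding K_def using a assms(3) m C(2) x N by (rule flat_product_ge)
    finally show ?thesis .
  qed
  moreover have "flat_product m \<gamma> (x, 0) \<in> \<real>" if "0 < x" for x
    by (simp only: flat_product_of_real(2)[OF a assms(3) m that] Reals_of_real)
  moreover have "norm (flat_product m \<gamma> z) \<le> 1 * assoc_fun M (1 * fst z)"
    if "z \<in> log_sector \<gamma>" for z
    unfolding assoc_fun_def mult_1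
    using norm_flat_product_le[OF a assms(3) m that]
    by (intro cINF_greatest) (auto simp: prod_m)
  moreover have "0 < exp (- \<gamma> * C)" "0 < K"
    by (simp_all add: K_def)
  ultimately have "optimal_flat M (log_sector \<gamma>) (flat_product m \<gamma>)"
    unfolding optimal_flat_def
    using holomorphic_flat_product[OF a assms(3)] assms(3) zero_less_one by blast
  then show ?thesis by blast
qed

end
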